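(* Let the network $f(x,\theta)$, inputs $x_1,\dots,x_N\in\mathbb{R}$, labels $y\in\mathbb{R}^N$ and the vectorized network $f(\theta)\in\mathbb{R}^N$ be as in the context, and let $\varepsilon>0$ be a cutoff. Let the parameters $\theta(t)\in\mathbb{R}^p$ evolve by Gauss--Newton (GN) preconditioned gradient descent in continuous time, $$\frac{\partial\theta}{\partial t}=-(J_t^TJ_t)^{\dagger}J_t^T\,e(t),$$ where $J_t=\nabla_\theta f(\theta(t))\in\mathbb{R}^{N\times p}$ is the Jacobian, $e(t)=f(\theta(t))-y$ is the error, and $\dagger$ denotes the matrix pseudoinverse calculated with cutoff $\varepsilon$ (defined in the context). Let $K_t=J_tJ_t^T\in\mathbb{R}^{N\times N}$, let $\Lambda=\mathrm{diag}(\lambda_i)\ge 0$ be the eigenvalues of $K_t$, written $\lambda_i=\lambda_i(e)$, and for $1\le i\le N$ let $\hat e_i(t)$ be the error coefficient associated with the $i$th eigenvector of $K_t$ (the coefficient of $e(t)$ along the $i$th vector of an orthonormal basis of eigenvectors of $K_t$). Then $$\frac{\partial}{\partial t}\hat e_i=-\mathbf{1}_{\lambda_i(e)>\varepsilon}\,\hat e_i ,$$ where $\mathbf{1}_{\lambda>\varepsilon}$ equals $1$ if $\lambda>\varepsilon$ and $0$ otherwise.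
   Context: Network: $f(x,\theta):\mathbb{R}\times\mathbb{R}^p\to\mathbb{R}$ is a multilayer perceptron of depth $L$ and constant width $W$, $$f(x,\theta)=\theta^{(L)}\sigma\Big(\tfrac{1}{\sqrt W}\theta^{(L-1)}\sigma\big(\cdots\sigma\big(\tfrac{1}{\sqrt W}\theta^{(1)}x+\beta b^{(1)}\big)\cdots\big)+\beta b^{(L-1)}\Big)+\beta b^{(L)},$$ where $\sigma$ is an activation function applied entrywise, $\beta$ is a fixed constant, and $\theta\in\mathbb{R}^p$ collects the network parameters. The initialization and scaling of the weights are those of the standard neural tangent kernel (NTK) parametrization of Jacot et al. (2018). Data and loss: $f(\theta)=(f(x_1,\theta),\dots,f(x_N,\theta))^T\in\mathbb{R}^N$, and the loss is $\mathcal{L}(\theta)=\frac12\|f(\theta)-y\|^2$. The GN flow is the continuous-time (step size $\eta\to0$) version of $\theta_{n+1}=\theta_n-\eta(J^TJ)^{\dagger}J^T(f(\theta_n)-y)$, with $J$ the Jacobian at $\theta_n$. The matrix $K_t$ is the time-dependent NTK matrix; it is symmetric positive semidefinite and has an orthogonal basis of eigenvectors. The notation $\lambda_i(e)$ records that $K_t$, its eigenvalues and its basis of eigenmodes evolve nonlinearly with $e$ (they are not assumed constant in time). Pseudoinverse with cutoff $\varepsilon$: for a symmetric positive semidefinite matrix $A=V\,\mathrm{diag}(\lambda_j)\,V^T$ with $V$ orthogonal, $A^\dagger=V\,\mathrm{diag}(\lambda_j')\,V^T$, where $\lambda_j'=1/\lambda_j$ if $\lambda_j>\varepsilon$ and $\lambda_j'=0$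 if $\lambda_j\le\varepsilon$.
   Formalization: The time derivative of the error coefficient is taken with the i-th eigenvector of K_t held fixed at time t; with a moving eigenbasis the extra term v_i'(t)·e(t) makes the stated formula false in general. The network is assumed differentiable at θ(t). *)

theory Defs
  imports "HOL-Analysis.Analysis"
begin

text \<open>
  Scalar parameters of the perceptron with scalar input, scalar output, \<open>L\<close> layers and hidden
  width \<open>W\<close>: \<open>Weight l i j\<close> is the entry \<open>(i, j)\<close> of \<open>\<theta>\<^sup>(\<^sup>l\<^sup>)\<close> and \<open>Bias l i\<close> is the entry \<open>i\<close> of
  \<open>b\<^sup>(\<^sup>l\<^sup>)\<close>. Layers are numbered from \<open>1\<close> to \<open>L\<close>, layer \<open>0\<close> being the input; neurons are numbered
  from \<open>0\<close>.
\<close>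

datatype mlp_param = Weight nat nat nat | Bias nat nat

definition layer_width :: "nat \<Rightarrow> nat \<Rightarrow> nat \<Rightarrow> nat" where
  "layer_width L W l = (if l = 0 \<or> l = L then 1 else W)"

definition mlp_params :: "nat \<Rightarrow> nat \<Rightarrow> mlp_param set" where
  "mlp_params L W =
     {Weight l i j | l i j. 1 \<le> l \<and> l \<le> L \<and> i < layer_width L W l \<and> j < layer_width L W (l - 1)}
     \<union> {Bias l i | l i. 1 \<le> l \<and> l \<le> L \<and> i < layer_width L W l}"

text \<open>
  \<open>mlp_hidden \<sigma> \<beta> L W P x l i\<close> is the output of neuron \<open>i\<close> of layer \<open>l < L\<close>, where \<open>P\<close> assigns
  values to the parameters. As in the formula for \<open>f\<close>, the factor \<open>1 / sqrt W\<close> is present in all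
  hidden layers, the first one included, and absent from the output layer.
\<close>

primrec mlp_hidden ::
  "(real \<Rightarrow> real) \<Rightarrow> real \<Rightarrow> nat \<Rightarrow> nat \<Rightarrow> (mlp_param \<Rightarrow> real) \<Rightarrow> real \<Rightarrow> nat \<Rightarrow> nat \<Rightarrow> real" where
  "mlp_hidden \<sigma> \<beta> L W P x 0 = (\<lambda>_. x)"
| "mlp_hidden \<sigma> \<beta> L W P x (Suc l) =
     (\<lambda>i. \<sigma> ((1 / sqrt (real W)) *
                (\<Sum>j<layer_width L W l. P (Weight (Suc l) i j) * mlp_hidden \<sigma> \<beta> L W P x l j)
              + \<beta> * P (Bias (Suc l) i)))"

definition mlp ::
  "(real \<Rightarrow> real) \<Rightarrow> real \<Rightarrow> nat \<Rightarrow> nat \<Rightarrow> (mlp_param \<Rightarrow> real) \<Rightarrow> real \<Rightarrow> real" where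
  "mlp \<sigma> \<beta> L W P x =
     (\<Sum>j<layer_width L W (L - 1). P (Weight L 0 j) * mlp_hidden \<sigma> \<beta> L W P x (L - 1) j)
     + \<beta> * P (Bias L 0)"

text \<open>
  The vectorized network on the inputs \<open>x\<close>. The function \<open>idx\<close> gives the coordinate of
  the parameter vector \<open>\<theta>\<close> in which each scalar parameter is stored.
\<close>

definition mlp_vec ::
  "(real \<Rightarrow> real) \<Rightarrow> real \<Rightarrow> nat \<Rightarrow> nat \<Rightarrow> (mlp_param \<Rightarrow> 'p) \<Rightarrow> real ^ 'n \<Rightarrow> real ^ 'p \<Rightarrow> real ^ 'n" where
  "mlp_vec \<sigma> \<beta> L W idx x \<theta> = (\<chi> k. mlp \<sigma> \<beta> L W (\<lambda>q. \<theta> $ idx q) (x $ k))"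

definition diag_matrix :: "('n \<Rightarrow> real) \<Rightarrow> real ^ 'n ^ 'n" where
  "diag_matrix d = (\<chi> i j. if i = j then d i else 0)"

text \<open>
  The result does not depend on the chosen orthogonal diagonalization, and one exists
  whenever \<open>A\<close> is symmetric; for other \<open>A\<close> the value is unspecified.
\<close>

definition pinv_cutoff :: "real \<Rightarrow> real ^ 'n ^ 'n \<Rightarrow> real ^ 'n ^ 'n" where
  "pinv_cutoff \<epsilon> A =
     (THE B. \<exists>V lam. orthogonal_matrix V \<and> A = V ** diag_matrix lam ** transpose V \<and>
        B = V ** diag_matrix (\<lambda>j. if lam j > \<epsilon> then 1 / lam j else 0) ** transpose V)"

definition orthonormal_eigenbasis ::
  "real ^ 'n ^ 'n \<Rightarrow> ('n \<Rightarrow> real ^ 'n) \<Rightarrow> ('n \<Rightarrow> real) \<Rightarrow> bool" where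
  "orthonormal_eigenbasis A v lam \<longleftrightarrow>
     (\<forall>i j. v i \<bullet> v j = (if i = j then 1 else 0)) \<and> (\<forall>i. A *v v i = lam i *\<^sub>R v i)"

text \<open>
  \<open>T\<close> is meant to be an interval; at its end points the derivative is one-sided.
\<close>

definition gauss_newton_flow ::
  "real \<Rightarrow> (real ^ 'p \<Rightarrow> real ^ 'n) \<Rightarrow> real ^ 'n \<Rightarrow> real set \<Rightarrow> (real \<Rightarrow> real ^ 'p) \<Rightarrow> bool" where
  "gauss_newton_flow \<epsilon> F y T \<theta> \<longleftrightarrow>
     (\<forall>t\<in>T. let J = jacobian F (at (\<theta> t)) in
        (\<theta> has_vector_derivative
           - (pinv_cutoff \<epsilon> (transpose J ** J) *v (transpose J *v (F (\<theta> t) - y))))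
          (at t within T))"

definition ntk :: "(real ^ 'p \<Rightarrow> real ^ 'n) \<Rightarrow> real ^ 'p \<Rightarrow> real ^ 'n ^ 'n" where
  "ntk F \<theta> = jacobian F (at \<theta>) ** transpose (jacobian F (at \<theta>))"

end

theory Submission
  imports Defs
begin

text \<open>
  The number \<open>v\<^sub>i \<bullet> (J (J\<^sup>TJ)\<^sup>\<dagger> J\<^sup>T e)\<close> equals \<open>((J\<^sup>TJ)\<^sup>\<dagger> u\<^sub>i) \<bullet> (J\<^sup>T e)\<close> with \<open>u\<^sub>i = J\<^sup>T v\<^sub>i\<close>. Since
  \<open>J\<^sup>TJ u\<^sub>i = J\<^sup>T K v\<^sub>i = \<lambda>\<^sub>i u\<^sub>i\<close>, the pseudoinverse multiplies \<open>u\<^sub>i\<close> by \<open>1 / \<lambda>\<^sub>i\<close> or by \<open>0\<close>, while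
  \<open>u\<^sub>i \<bullet> (J\<^sup>T e) = (K v\<^sub>i) \<bullet> e = \<lambda>\<^sub>i (v\<^sub>i \<bullet> e)\<close>.
  The pseudoinverse is well defined because the nonzero \<open>u\<^sub>i\<close>, completed by vectors in the
  kernel of \<open>J\<close>, form an orthogonal eigenbasis of \<open>J\<^sup>TJ\<close>.
\<close>

lemma diag_matrix_vec [simp]: "(diag_matrix d *v c) $ j = d j * c $ j"
proof -
  have "(diag_matrix d *v c) $ j = (\<Sum>k\<in>UNIV. if k = j then d j * c $ k else 0)"
    unfolding diag_matrix_def matrix_vector_mult_def vec_lambda_beta by (rule sum.cong) auto
  then show ?thesis by simp
qed

lemma transpose_diag_matrix [simp]: "transpose (diag_matrix d) = diag_matrix d"
  by (auto simp: diag_matrix_def transpose_def vec_eq_iff)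

text \<open>In the coordinates \<open>c = transpose V *v w\<close> the eigenvalue equation reads
  \<open>d j * c $ j = \<mu> * c $ j\<close>. So each \<open>j\<close> has \<open>c $ j = 0\<close>
  or \<open>d j = \<mu>\<close>, and in both cases \<open>d j\<close> and \<open>\<mu>\<close> may
  be replaced by their images under an arbitrary \<open>h\<close>.\<close>

lemma orthogonal_conj_eigenvector:
  fixes V :: "real ^ 'n ^ 'n"
  assumes V: "orthogonal_matrix V"
    and w: "(V ** diag_matrix d ** transpose V) *v w = \<mu> *\<^sub>R w"
  shows "(V ** diag_matrix (\<lambda>j. h (d j)) ** transpose V) *v w = h \<mu> *\<^sub>R w"
proof -
  have VV: "transpose V ** V = mat 1" "V ** transpose V = mat 1"
    using V by (auto simp: orthogonal_matrix_def)
  define c where "c = transpose V *v w"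
  have "diag_matrix d *v c = transpose V *v ((V ** diag_matrix d ** transpose V) *v w)"
    by (simp only: c_def matrix_vector_mul_assoc matrix_mul_assoc VV matrix_mul_lid)
  also have "\<dots> = \<mu> *\<^sub>R c"
    by (simp add: w c_def matrix_vector_mult_scaleR)
  finally have "d j * c $ j = \<mu> * c $ j" for j
    by (metis diag_matrix_vec vector_scaleR_component real_scaleR_def)
  then have "diag_matrix (\<lambda>j. h (d j)) *v c = h \<mu> *\<^sub>R c"
    by (auto simp: vec_eq_iff)
  then have "V *v (diag_matrix (\<lambda>j. h (d j)) *v c) = h \<mu> *\<^sub>R (V *v c)"
    by (simp add: matrix_vector_mult_scaleR)
  then show ?thesis
    by (simp only: c_def matrix_vector_mul_assoc matrix_mul_assoc VV matrix_vector_mul_lid)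
qed

text \<open>The functional calculus \<open>h(A)\<close> does not depend on the diagonalization of
  \<open>A\<close>: every column of \<open>V\<close> is an eigenvector of the common matrix, so both
  candidates scale it by \<open>h (d j)\<close>, and the columns of \<open>V\<close> form a
  basis.\<close>

lemma orthogonal_conj_unique:
  fixes V U :: "real ^ 'n ^ 'n"
  assumes V: "orthogonal_matrix V" and U: "orthogonal_matrix U"
    and eq: "V ** diag_matrix d ** transpose V = U ** diag_matrix d' ** transpose U"
  shows "V ** diag_matrix (\<lambda>j. h (d j)) ** transpose V
       = U ** diag_matrix (\<lambda>j. h (d' j)) ** transpose U" (is "?B = ?C")
proof -
  have VV: "transpose V ** V = mat 1" "V ** transpose V = mat 1"
    using V by (auto simp: orthogonal_matrix_def)
  have "(?C ** V) *v axis j 1 = (?B ** V) *v axis j 1" for j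
  proof -
    let ?w = "V *v axis j 1"
    have "(V ** diag_matrix d ** transpose V) *v ?w = V *v (diag_matrix d *v axis j 1)"
      by (metis VV(1) matrix_mul_assoc matrix_mul_rid matrix_vector_mul_assoc)
    also have "diag_matrix d *v axis j 1 = d j *\<^sub>R axis j 1"
      by (simp add: vec_eq_iff axis_def)
    finally have w: "(V ** diag_matrix d ** transpose V) *v ?w = d j *\<^sub>R ?w"
      by (simp add: matrix_vector_mult_scaleR)
    then have "?C *v ?w = h (d j) *\<^sub>R ?w"
      using orthogonal_conj_eigenvector[OF U] eq by metis
    with orthogonal_conj_eigenvector[OF V w] show ?thesis
      by (simp add: matrix_vector_mul_assoc)
  qed
  \<comment> \<open>Agreement on all standard basis vectors is equality of all columns;
    \<open>V\<close> is then cancelled by its transpose.\<close>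
  then have "?C ** V = ?B ** V"
    by (simp add: matrix_vector_mult_basis column_def vec_eq_iff)
  then have "?C ** V ** transpose V = ?B ** V ** transpose V"
    by simp
  then show ?thesis
    by (metis VV(2) matrix_mul_assoc matrix_mul_rid)
qed

text \<open>Resolves the definite description: any one diagonalization is a witness, and uniqueness
  is the functional calculus applied to the cutoff reciprocal.\<close>

lemma pinv_cutoff_eq:
  fixes V :: "real ^ 'n ^ 'n"
  assumes "orthogonal_matrix V" and "A = V ** diag_matrix d ** transpose V"
  shows "pinv_cutoff \<epsilon> A =
    V ** diag_matrix (\<lambda>j. if d j > \<epsilon> then 1 / d j else 0) ** transpose V"
  unfolding pinv_cutoff_def
proof (rule the_equality)
  show "\<exists>U lam. orthogonal_matrix U \<and> A = U ** diag_matrix lam ** transpose U \<and>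
      V ** diag_matrix (\<lambda>j. if d j > \<epsilon> then 1 / d j else 0) ** transpose V =
      U ** diag_matrix (\<lambda>j. if lam j > \<epsilon> then 1 / lam j else 0) ** transpose U"
    using assms by blast
next
  fix B
  assume "\<exists>U lam. orthogonal_matrix U \<and> A = U ** diag_matrix lam ** transpose U \<and>
      B = U ** diag_matrix (\<lambda>j. if lam j > \<epsilon> then 1 / lam j else 0) ** transpose U"
  then obtain U lam where U: "orthogonal_matrix U" "A = U ** diag_matrix lam ** transpose U"
    and B: "B = U ** diag_matrix (\<lambda>j. if lam j > \<epsilon> then 1 / lam j else 0) ** transpose U"
    by blast
  have "U ** diag_matrix lam ** transpose U = V ** diag_matrix d ** transpose V"
    using U(2) assms(2) by simp
  then show "B = V ** diag_matrix (\<lambda>j. if d j > \<epsilon> then 1 / d j else 0) ** transpose V"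
    unfolding B
    by (rule orthogonal_conj_unique[OF U(1) assms(1), where h = "\<lambda>z. if z > \<epsilon> then 1 / z else 0"])
qed

text \<open>The normalized elements of \<open>B\<close> serve as the columns of \<open>V\<close>. An
  orthogonal spanning set without \<open>0\<close> is a basis, so it has exactly
  \<open>CARD('n)\<close> elements and can be indexed by the type \<open>'n\<close>.\<close>

lemma orthogonal_diagonalization_exists:
  fixes A :: "real ^ 'n ^ 'n"
  assumes orth: "pairwise orthogonal B" and "0 \<notin> B" and span: "span B = UNIV"
    and eig: "\<And>b. b \<in> B \<Longrightarrow> \<exists>\<mu>. A *v b = \<mu> *\<^sub>R b"
  obtains V d where "orthogonal_matrix V" "A = V ** diag_matrix d ** transpose V"
proof -
  have indep: "independent B"
    using pairwise_orthogonal_independent assms by blast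
  have "card B = CARD('n)"
    using basis_card_eq_dim[of B UNIV] indep span by (simp add: dim_UNIV)
  moreover have "finite B"
    using indep by (rule independent_imp_finite)
  ultimately obtain g where g: "bij_betw g (UNIV :: 'n set) B"
    using finite_same_card_bij[of "UNIV :: 'n set" B] by auto
  have gB: "g j \<in> B" for j
    using g bij_betwE by blast
  then have g0: "g j \<noteq> 0" for j
    using \<open>0 \<notin> B\<close> by metis
  have "\<exists>d. \<forall>j. A *v g j = d j *\<^sub>R g j"
    by (intro choice allI eig gB)
  then obtain d where d: "\<And>j. A *v g j = d j *\<^sub>R g j"
    by blast
  define q where "q j = g j /\<^sub>R norm (g j)" for j
  define V :: "real ^ 'n ^ 'n" where "V = (\<chi> i j. q j $ i)"
  have Aq: "A *v q j = d j *\<^sub>R q j" for j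
    by (simp only: q_def matrix_vector_mult_scaleR d scaleR_left_commute)
  have qq: "q i \<bullet> q j = (if i = j then 1 else 0)" for i j
  proof (cases "i = j")
    case True
    then show ?thesis
      using g0[of j] by (simp add: q_def dot_square_norm power2_eq_square)
  next
    case False
    then have "g i \<noteq> g j"
      using g by (metis UNIV_I bij_betw_inv_into_left)
    then have "g i \<bullet> g j = 0"
      using orth gB unfolding pairwise_def orthogonal_def by blast
    then show ?thesis using False by (simp add: q_def)
  qed
  have "(transpose V ** V) $ i $ j = q i \<bullet> q j" for i j
    by (simp add: V_def matrix_matrix_mult_def transpose_def inner_vec_def)
  then have "transpose V ** V = mat 1"
    by (simp add: vec_eq_iff qq mat_def)
  then have V: "orthogonal_matrix V"
    by (simp add: orthogonal_matrix)
  \<comment> \<open>Column by column, \<open>A ** V = V ** diag_matrix d\<close> is the eigenvalue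
    equation for \<open>q j\<close>.\<close>
  have "(A ** V) $ i $ j = (A *v q j) $ i" for i j
    by (simp add: V_def matrix_matrix_mult_def matrix_vector_mult_def)
  moreover have "(V ** diag_matrix d) $ i $ j = (d j *\<^sub>R q j) $ i" for i j
  proof -
    have "(V ** diag_matrix d) $ i $ j = (\<Sum>k\<in>UNIV. if k = j then q k $ i * d k else 0)"
      unfolding V_def matrix_matrix_mult_def diag_matrix_def vec_lambda_beta
      by (rule sum.cong) auto
    then show ?thesis by (simp add: mult.commute)
  qed
  ultimately have "A ** V = V ** diag_matrix d"
    by (simp add: vec_eq_iff Aq)
  then have "A = V ** diag_matrix d ** transpose V"
    using V by (metis matrix_mul_assoc matrix_mul_rid orthogonal_matrix_def)
  with V show thesis by (rule that)
qed

text \<open>The basis vectors are the rows of a square matrix \<open>V\<close> with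
  \<open>V ** transpose V = mat 1\<close>. Its right inverse is also a left inverse, so
  \<open>V *v z = 0\<close> forces \<open>z = 0\<close>.\<close>

lemma eigenbasis_nonzero_complete:
  fixes v :: "'n \<Rightarrow> real ^ 'n"
  assumes "orthonormal_eigenbasis A v lam" and "\<And>i. v i \<bullet> z = 0"
  shows "z = 0"
proof -
  define V :: "real ^ 'n ^ 'n" where "V = (\<chi> i. v i)"
  have "(V ** transpose V) $ i $ j = v i \<bullet> v j" for i j
    by (simp add: V_def matrix_matrix_mult_def transpose_def inner_vec_def)
  then have "V ** transpose V = mat 1"
    using assms(1) by (simp add: vec_eq_iff mat_def orthonormal_eigenbasis_def)
  then have "transpose V ** V = mat 1"
    using matrix_left_right_inverse by blast
  moreover have "V *v z = 0"
    using assms(2) by (simp add: V_def vec_eq_iff matrix_vector_mul_component)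
  ultimately show ?thesis
    by (metis matrix_vector_mul_assoc matrix_vector_mul_lid matrix_vector_mult_0_right)
qed

lemma inner_matrix_vector_transpose:
  fixes M :: "real ^ 'k ^ 'm"
  shows "a \<bullet> (M *v b) = (transpose M *v a) \<bullet> b"
  by (simp add: dot_lmul_matrix)

text \<open>Carries eigenpairs of \<open>J ** transpose J\<close> over to
  \<open>transpose J ** J\<close>. The transported vector vanishes exactly when
  \<open>lam i = 0\<close>.\<close>

lemma gram_eigenvector:
  fixes J :: "real ^ 'p ^ 'n"
  assumes "orthonormal_eigenbasis (J ** transpose J) v lam"
  shows "(transpose J ** J) *v (transpose J *v v i) = lam i *\<^sub>R (transpose J *v v i)"
proof -
  have "(transpose J ** J) *v (transpose J *v v i) = transpose J *v ((J ** transpose J) *v v i)"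
    by (simp only: matrix_vector_mul_assoc matrix_mul_assoc)
  also have "(J ** transpose J) *v v i = lam i *\<^sub>R v i"
    using assms by (simp add: orthonormal_eigenbasis_def)
  finally show ?thesis
    by (simp only: matrix_vector_mult_scaleR)
qed

lemma gram_orthogonal_diagonalization:
  fixes J :: "real ^ 'p ^ 'n"
  assumes eb: "orthonormal_eigenbasis (J ** transpose J) v lam"
  obtains V d where "orthogonal_matrix V" "transpose J ** J = V ** diag_matrix d ** transpose V"
proof -
  let ?u = "\<lambda>i. transpose J *v v i"
  have uu: "?u i \<bullet> ?u j = (if i = j then lam j else 0)" for i j
  proof -
    have "?u i \<bullet> ?u j = v i \<bullet> ((J ** transpose J) *v v j)"
      by (simp only: inner_matrix_vector_transpose[of _ J] flip: matrix_vector_mul_assoc)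
    then show ?thesis
      using eb by (simp add: orthonormal_eigenbasis_def)
  qed
  \<comment> \<open>Distinct elements of the range come from distinct indices, to which
    \<open>uu\<close> applies.\<close>
  have "pairwise orthogonal (range ?u - {0})"
    unfolding pairwise_def orthogonal_def using uu by force
  then obtain U where U: "U \<inter> insert 0 (range ?u - {0}) = {}"
      "pairwise orthogonal ((range ?u - {0}) \<union> U)"
      "span ((range ?u - {0}) \<union> U) = span ((range ?u - {0}) \<union> UNIV)"
    by (rule orthogonal_extension_strong)
  \<comment> \<open>An added vector \<open>w\<close> is orthogonal to every
    \<open>transpose J *v v i\<close>, so \<open>J *v w\<close> is orthogonal to every
    \<open>v i\<close>. Disjointness in \<open>U(1)\<close> ensures that \<open>w\<close> differs
    from the nonzero \<open>?u i\<close>, as pairwise orthogonality requires.\<close>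
  have kernel: "J *v w = 0" if "w \<in> U" for w
  proof (rule eigenbasis_nonzero_complete[OF eb])
    fix i
    have "?u i \<bullet> w = 0"
    proof (cases "?u i = 0")
      case False
      then have "?u i \<noteq> w" using U(1) that by blast
      with False show ?thesis
        using U(2) that unfolding pairwise_def orthogonal_def by blast
    qed simp
    then show "v i \<bullet> (J *v w) = 0"
      by (simp add: dot_lmul_matrix)
  qed
  have "\<exists>\<mu>. (transpose J ** J) *v b = \<mu> *\<^sub>R b" if "b \<in> (range ?u - {0}) \<union> U" for b
  proof (cases "b \<in> U")
    case True
    then have "(transpose J ** J) *v b = 0 *\<^sub>R b"
      by (simp add: kernel flip: matrix_vector_mul_assoc)
    then show ?thesis ..
  next
    case False
    then show ?thesis
      using that gram_eigenvector[OF eb] by blast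
  qed
  then show thesis
    using orthogonal_diagonalization_exists[of "(range ?u - {0}) \<union> U"] U that by auto
qed

text \<open>In function space the preconditioned step is the orthogonal projection of
  \<open>e\<close> onto the eigenmodes of \<open>J ** transpose J\<close> above the cutoff.\<close>

lemma inner_gauss_newton_direction:
  fixes J :: "real ^ 'p ^ 'n"
  assumes eb: "orthonormal_eigenbasis (J ** transpose J) v lam" and "\<epsilon> > 0"
  shows "v i \<bullet> (J *v (pinv_cutoff \<epsilon> (transpose J ** J) *v (transpose J *v e)))
       = (if lam i > \<epsilon> then 1 else 0) * (v i \<bullet> e)"
proof -
  obtain V d where V: "orthogonal_matrix V"
      and J: "transpose J ** J = V ** diag_matrix d ** transpose V"
    using gram_orthogonal_diagonalization[OF eb] .
  define h where "h z = (if z > \<epsilon> then 1 / z else 0)" for z :: real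
  define P where "P = pinv_cutoff \<epsilon> (transpose J ** J)"
  have P: "P = V ** diag_matrix (\<lambda>j. h (d j)) ** transpose V"
    unfolding P_def h_def by (rule pinv_cutoff_eq[OF V J])
  \<comment> \<open>Symmetry is visible in the diagonalized form; it lets \<open>P\<close> move to
    the other side of the inner product.\<close>
  then have sym: "transpose P = P"
    by (simp add: matrix_transpose_mul matrix_mul_assoc)
  let ?u = "transpose J *v v i"
  have Pu: "P *v ?u = h (lam i) *\<^sub>R ?u"
    unfolding P using orthogonal_conj_eigenvector[OF V] gram_eigenvector[OF eb] J by metis
  have "v i \<bullet> (J *v (P *v (transpose J *v e))) = (P *v ?u) \<bullet> (transpose J *v e)"
    by (simp only: inner_matrix_vector_transpose[of _ J] inner_matrix_vector_transpose[of _ P] sym)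
  also have "\<dots> = h (lam i) * (?u \<bullet> (transpose J *v e))"
    by (simp only: Pu inner_scaleR_left)
  also have "\<dots> = h (lam i) * (((J ** transpose J) *v v i) \<bullet> e)"
    by (simp only: inner_matrix_vector_transpose[of _ "transpose J"] transpose_transpose
        matrix_vector_mul_assoc)
  also have "\<dots> = h (lam i) * lam i * (v i \<bullet> e)"
    using eb by (simp add: orthonormal_eigenbasis_def)
  \<comment> \<open>Above the cutoff \<open>lam i\<close> is nonzero because
    \<open>\<epsilon>\<close> is positive, so the reciprocal cancels it.\<close>
  also have "h (lam i) * lam i = (if lam i > \<epsilon> then 1 else 0)"
    using \<open>\<epsilon> > 0\<close> by (simp add: h_def)
  finally show ?thesis
    unfolding P_def .
qed

text \<open>The eigenbasis moves with time, and the derivative of the \<open>i\<close>th coefficient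
  is read as the \<open>i\<close>th component of the derivative of the error: \<open>v t i\<close>
  is frozen at the time \<open>t\<close> of differentiation while \<open>e s\<close> varies. At an
  end point of \<open>T\<close> the derivative is one-sided.\<close>

theorem lemma3p3:
  fixes \<sigma> :: "real \<Rightarrow> real" and \<beta> \<epsilon> :: real and L W :: nat
    and idx :: "mlp_param \<Rightarrow> 'p::finite"
    and x y :: "real ^ 'n::finite"
    and f :: "real ^ 'p \<Rightarrow> real ^ 'n"
    and T :: "real set" and \<theta> :: "real \<Rightarrow> real ^ 'p" and e :: "real \<Rightarrow> real ^ 'n"
    and v :: "real \<Rightarrow> 'n \<Rightarrow> real ^ 'n" and lam :: "real \<Rightarrow> 'n \<Rightarrow> real"
  assumes "L \<ge> 1" and "W \<ge> 1"
    and "bij_betw idx (mlp_params L W) UNIV"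
    and "f = mlp_vec \<sigma> \<beta> L W idx x"
    and "\<epsilon> > 0"
    and "is_interval T"
    and "\<And>t. t \<in> T \<Longrightarrow> f differentiable at (\<theta> t)"
    and "gauss_newton_flow \<epsilon> f y T \<theta>"
    and "\<And>t. e t = f (\<theta> t) - y"
    and "\<And>t. t \<in> T \<Longrightarrow> orthonormal_eigenbasis (ntk f (\<theta> t)) (v t) (lam t)"
  shows "\<forall>t\<in>T. \<forall>i.
    ((\<lambda>s. v t i \<bullet> e s) has_real_derivative
       - (if lam t i > \<epsilon> then 1 else 0) * (v t i \<bullet> e t)) (at t within T)"
proof (intro ballI allI)
  fix t i
  assume t: "t \<in> T"
  define J where "J = jacobian f (at (\<theta> t))"
  define D where "D = - (pinv_cutoff \<epsilon> (transpose J ** J) *v (transpose J *v e t))"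
  have "(\<theta> has_vector_derivative D) (at t within T)"
    using \<open>gauss_newton_flow \<epsilon> f y T \<theta>\<close> t
    unfolding gauss_newton_flow_def D_def J_def assms(9) Let_def by blast
  moreover have "(f has_derivative (\<lambda>h. J *v h)) (at (\<theta> t))"
    unfolding J_def using assms(7)[OF t] jacobian_works by blast
  ultimately have "((\<lambda>s. f (\<theta> s)) has_derivative (\<lambda>h. J *v (h *\<^sub>R D))) (at t within T)"
    unfolding has_vector_derivative_def by (rule has_derivative_compose)
  \<comment> \<open>The subtracted \<open>0\<close> is the derivative of the constant label vector
    \<open>y\<close>.\<close>
  then have "(e has_derivative (\<lambda>h. J *v (h *\<^sub>R D) - 0)) (at t within T)"
    unfolding assms(9) by (intro has_derivative_diff has_derivative_const)
  then have "((\<lambda>s. v t i \<bullet> e s) has_derivative (\<lambda>h. v t i \<bullet> (J *v (h *\<^sub>R D) - 0))) (at t within T)"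
    by (rule has_derivative_inner_right)
  moreover have "v t i \<bullet> (J *v D) = - (if lam t i > \<epsilon> then 1 else 0) * (v t i \<bullet> e t)"
    using inner_gauss_newton_direction[of J "v t" "lam t" \<epsilon> i "e t"] assms(10)[OF t] \<open>\<epsilon> > 0\<close>
    unfolding ntk_def J_def[symmetric] D_def by (simp add: linear_neg)
  ultimately show "((\<lambda>s. v t i \<bullet> e s) has_real_derivative
       - (if lam t i > \<epsilon> then 1 else 0) * (v t i \<bullet> e t)) (at t within T)"
    unfolding has_field_derivative_def
    by (simp only: matrix_vector_mult_scaleR inner_scaleR_right diff_zero real_scaleR_def mult_commute_abs)
qed

end
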